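(* Let $X$ be a complex Banach space and $A, B \in \mathscr{L}(X)$. If the point spectra $\sigma_{\mathrm{p}}(A^* )$ and $\sigma_{\mathrm{p}}(B)$ are both nonempty, then the generalised derivation $\tau_{A,B} \colon J \to J$, $\tau_{A,B}(T) = AT - TB$, is not hypercyclic on any separable Banach ideal $J \subset \mathscr{L}(X)$.
   Context: $\mathscr{L}(X)$ is the space of bounded linear operators on $X$; $A^* \in \mathscr{L}(X^* )$ is the adjoint; $\sigma_{\mathrm{p}}$ denotes the set of eigenvalues. Banach ideal: $(J, \lVert\cdot\rVert_J)$ is a Banach ideal of $\mathscr{L}(X)$ if (i) $J \subset \mathscr{L}(X)$ is a linear subspace; (ii) the norm $\lVert\cdot\rVert_J$ is complete in $J$ and $\lVert S\rVert \le \lVert S\rVert_J$ for all $S \in J$; (iii) $BSA \in J$ and $\lVert BSA\rVert_J \le \lVert B\rVert\,\lVert A\rVert\,\lVert S\rVert_J$ for all $A,B \in \mathscr{L}(X)$, $S \in J$; (iv) the rank one operators $x^*\otimes x \colon z \mapsto x^*(z)x$ belong to $J$ and $\lVert x^*\otimes x\rVert_J = \lVert x^*\rVert\,\lVert x\rVert$ for all $x^* \in X^*$, $x \in X$. Separability of $J$ is with respect to $\lVert\cdot\rVert_J$. A bounded operator $U$ on a separable Banach space $Y$ is hypercyclic if there is $y \in Y$ whose orbit $\{U^n y : n \ge 0\}$ is dense in $Y$. *)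

theory Defs
  imports "HOL-Analysis.Analysis"
begin

text \<open>A complex normed space is a real normed space together with a compatible complex scalar
  multiplication, so that the library notions for real normed spaces apply to it.\<close>

class scaleC =
  fixes scaleC :: "complex \<Rightarrow> 'a \<Rightarrow> 'a"  (infixr \<open>*\<^sub>C\<close> 75)

class complex_vector = real_vector + scaleC +
  assumes scaleC_add_right: "a *\<^sub>C (x + y) = a *\<^sub>C x + a *\<^sub>C y"
    and scaleC_add_left: "(a + b) *\<^sub>C x = a *\<^sub>C x + b *\<^sub>C x"
    and scaleC_scaleC [simp]: "a *\<^sub>C (b *\<^sub>C x) = (a * b) *\<^sub>C x"
    and scaleC_one [simp]: "1 *\<^sub>C x = x"
    and scaleR_scaleC: "r *\<^sub>R x = complex_of_real r *\<^sub>C x"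

class complex_normed_vector = complex_vector + real_normed_vector +
  assumes norm_scaleC [simp]: "norm (a *\<^sub>C x) = cmod a * norm x"

class complex_banach = complex_normed_vector + complete_space

subclass (in complex_banach) banach ..

global_interpretation complex_vector:
  vector_space "scaleC :: complex \<Rightarrow> 'a \<Rightarrow> 'a::complex_vector"
  by unfold_locales (simp_all add: scaleC_add_right scaleC_add_left)

lemma bounded_linear_scaleC_right: "bounded_linear (\<lambda>x::'a::complex_normed_vector. c *\<^sub>C x)"
  by (rule bounded_linear_intro[of _ "cmod c"])
    (simp_all add: scaleC_add_right scaleR_scaleC mult.commute)

lemma bounded_linear_scaleC_left: "bounded_linear (\<lambda>c. c *\<^sub>C (x::'a::complex_normed_vector))"
  by (rule bounded_linear_intro[of _ "norm x"])
    (simp_all add: scaleC_add_left scaleR_scaleC scaleR_conv_of_real)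

instantiation complex :: complex_banach
begin
definition scaleC_complex :: "complex \<Rightarrow> complex \<Rightarrow> complex" where
  "scaleC_complex c z = c * z"
instance
  by standard (simp_all add: scaleC_complex_def norm_mult algebra_simps scaleR_conv_of_real)
end

instantiation blinfun :: (real_normed_vector, complex_normed_vector) complex_normed_vector
begin
lift_definition scaleC_blinfun :: "complex \<Rightarrow> 'a \<Rightarrow>\<^sub>L 'b \<Rightarrow> 'a \<Rightarrow>\<^sub>L 'b" is "\<lambda>c f x. c *\<^sub>C f x"
  by (rule bounded_linear_compose[OF bounded_linear_scaleC_right])
instance
proof
  fix c :: complex and f :: "'a \<Rightarrow>\<^sub>L 'b"
  have "onorm (\<lambda>x. c *\<^sub>C f x) = cmod c * onorm (blinfun_apply f)"
  proof (cases "c = 0")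
    case True
    then show ?thesis by (simp add: onorm_zero)
  next
    case False
    have 1: "onorm (\<lambda>x. d *\<^sub>C g x) \<le> cmod d * onorm g"
      if "bounded_linear g" for d and g :: "'a \<Rightarrow> 'b"
      by (rule onorm_bound)
        (use that onorm[OF that] in \<open>auto simp: mult.assoc mult_left_mono onorm_pos_le\<close>)
    have bl: "bounded_linear (\<lambda>x. c *\<^sub>C f x)"
      by (rule bounded_linear_compose[OF bounded_linear_scaleC_right blinfun.bounded_linear_right])
    have "onorm (blinfun_apply f) \<le> cmod (inverse c) * onorm (\<lambda>x. c *\<^sub>C f x)"
      using 1[OF bl, of "inverse c"] False by simp
    then have "cmod c * onorm (blinfun_apply f) \<le> onorm (\<lambda>x. c *\<^sub>C f x)"
      using False by (simp add: norm_inverse norm_divide field_simps)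
    with 1[OF blinfun.bounded_linear_right, of c f] show ?thesis by simp
  qed
  then show "norm (c *\<^sub>C f) = cmod c * norm f"
    by (simp add: norm_blinfun.rep_eq scaleC_blinfun.rep_eq)
qed (transfer; simp add: fun_eq_iff scaleC_add_right scaleC_add_left scaleR_scaleC)+
end

text \<open>The bounded complex-linear maps, with the operator norm inherited from the type of
  bounded real-linear maps.\<close>

typedef (overloaded) ('a, 'b) cblinfun  (\<open>(_ \<Rightarrow>\<^sub>C\<^sub>L /_)\<close> [22, 21] 21) =
  "{f :: 'a::complex_normed_vector \<Rightarrow>\<^sub>L 'b::complex_normed_vector.
      \<forall>c x. blinfun_apply f (c *\<^sub>C x) = c *\<^sub>C blinfun_apply f x}"
  morphisms blinfun_of Abs_cblinfun
  by (rule exI[of _ 0]) simp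

setup_lifting type_definition_cblinfun

lift_definition cblinfun_apply ::
    "('a::complex_normed_vector \<Rightarrow>\<^sub>C\<^sub>L 'b::complex_normed_vector) \<Rightarrow> 'a \<Rightarrow> 'b"
  is blinfun_apply .

declare [[coercion cblinfun_apply]]

lemma cblinfun_eqI: "(\<And>x. f x = g x) \<Longrightarrow> f = g" for f g :: "_ \<Rightarrow>\<^sub>C\<^sub>L _"
  by transfer (rule blinfun_eqI)

lemma cblinfun_apply_scaleC: "f (c *\<^sub>C x) = c *\<^sub>C f x" for f :: "_ \<Rightarrow>\<^sub>C\<^sub>L _"
  by transfer simp

lemma bounded_linear_cblinfun_apply: "bounded_linear (cblinfun_apply f)"
  by transfer (rule blinfun.bounded_linear_right)

instantiation cblinfun :: (complex_normed_vector, complex_normed_vector) complex_normed_vector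
begin
lift_definition zero_cblinfun :: "'a \<Rightarrow>\<^sub>C\<^sub>L 'b" is 0 by simp
lift_definition plus_cblinfun :: "('a \<Rightarrow>\<^sub>C\<^sub>L 'b) \<Rightarrow> ('a \<Rightarrow>\<^sub>C\<^sub>L 'b) \<Rightarrow> 'a \<Rightarrow>\<^sub>C\<^sub>L 'b" is "(+)"
  by (simp add: blinfun.add_left scaleC_add_right)
lift_definition minus_cblinfun :: "('a \<Rightarrow>\<^sub>C\<^sub>L 'b) \<Rightarrow> ('a \<Rightarrow>\<^sub>C\<^sub>L 'b) \<Rightarrow> 'a \<Rightarrow>\<^sub>C\<^sub>L 'b" is "(-)"
  by (simp add: blinfun.diff_left complex_vector.scale_right_diff_distrib)
lift_definition uminus_cblinfun :: "('a \<Rightarrow>\<^sub>C\<^sub>L 'b) \<Rightarrow> 'a \<Rightarrow>\<^sub>C\<^sub>L 'b" is uminus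
  by (simp add: blinfun.minus_left)
lift_definition scaleC_cblinfun :: "complex \<Rightarrow> ('a \<Rightarrow>\<^sub>C\<^sub>L 'b) \<Rightarrow> 'a \<Rightarrow>\<^sub>C\<^sub>L 'b" is scaleC
  by (simp add: scaleC_blinfun.rep_eq mult.commute)
lift_definition scaleR_cblinfun :: "real \<Rightarrow> ('a \<Rightarrow>\<^sub>C\<^sub>L 'b) \<Rightarrow> 'a \<Rightarrow>\<^sub>C\<^sub>L 'b" is scaleR
  by (simp add: scaleR_scaleC scaleC_blinfun.rep_eq mult.commute)
lift_definition norm_cblinfun :: "('a \<Rightarrow>\<^sub>C\<^sub>L 'b) \<Rightarrow> real" is norm .
definition dist_cblinfun :: "('a \<Rightarrow>\<^sub>C\<^sub>L 'b) \<Rightarrow> ('a \<Rightarrow>\<^sub>C\<^sub>L 'b) \<Rightarrow> real" where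
  "dist_cblinfun f g = norm (f - g)"
definition sgn_cblinfun :: "('a \<Rightarrow>\<^sub>C\<^sub>L 'b) \<Rightarrow> 'a \<Rightarrow>\<^sub>C\<^sub>L 'b" where
  "sgn_cblinfun f = scaleR (inverse (norm f)) f"
definition [code del]:
  "(uniformity :: (('a \<Rightarrow>\<^sub>C\<^sub>L 'b) \<times> ('a \<Rightarrow>\<^sub>C\<^sub>L 'b)) filter) =
    (INF e\<in>{0 <..}. principal {(f, g). dist f g < e})"
definition open_cblinfun :: "('a \<Rightarrow>\<^sub>C\<^sub>L 'b) set \<Rightarrow> bool" where
  [code del]: "open_cblinfun S =
    (\<forall>f\<in>S. \<forall>\<^sub>F (f', g) in uniformity. f' = f \<longrightarrow> g \<in> S)"
instance
proof
  fix f g h :: "'a \<Rightarrow>\<^sub>C\<^sub>L 'b" and r s :: real and c d :: complex and S :: "('a \<Rightarrow>\<^sub>C\<^sub>L 'b) set"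
  show "f + g + h = f + (g + h)" by transfer simp
  show "f + g = g + f" by transfer simp
  show "0 + f = f" by transfer simp
  show "- f + f = 0" by transfer simp
  show "f - g = f + - g" by transfer simp
  show "r *\<^sub>R (f + g) = r *\<^sub>R f + r *\<^sub>R g" by transfer (rule scaleR_add_right)
  show "(r + s) *\<^sub>R f = r *\<^sub>R f + s *\<^sub>R f" by transfer (rule scaleR_add_left)
  show "r *\<^sub>R s *\<^sub>R f = (r * s) *\<^sub>R f" by transfer simp
  show "1 *\<^sub>R f = f" by transfer simp
  show "c *\<^sub>C (f + g) = c *\<^sub>C f + c *\<^sub>C g" by transfer (rule scaleC_add_right)
  show "(c + d) *\<^sub>C f = c *\<^sub>C f + d *\<^sub>C f" by transfer (rule scaleC_add_left)
  show "c *\<^sub>C d *\<^sub>C f = (c * d) *\<^sub>C f" by transfer simp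
  show "1 *\<^sub>C f = f" by transfer simp
  show "r *\<^sub>R f = complex_of_real r *\<^sub>C f" by transfer (rule scaleR_scaleC)
  show "dist f g = norm (f - g)" by (rule dist_cblinfun_def)
  show "sgn f = scaleR (inverse (norm f)) f" by (rule sgn_cblinfun_def)
  show "uniformity = (INF e\<in>{0 <..}. principal {(f, g :: 'a \<Rightarrow>\<^sub>C\<^sub>L 'b). dist f g < e})"
    by (rule uniformity_cblinfun_def)
  show "open S = (\<forall>f\<in>S. \<forall>\<^sub>F (f', g) in uniformity. f' = f \<longrightarrow> g \<in> S)"
    by (rule open_cblinfun_def)
  show "norm f = 0 \<longleftrightarrow> f = 0" by transfer simp
  show "norm (f + g) \<le> norm f + norm g" by transfer (rule norm_triangle_ineq)
  show "norm (r *\<^sub>R f) = \<bar>r\<bar> * norm f" by transfer simp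
  show "norm (c *\<^sub>C f) = cmod c * norm f" by transfer simp
qed
end

lemma norm_cblinfun_eq_onorm: "norm f = onorm (cblinfun_apply f)"
  by (simp add: norm_cblinfun.rep_eq norm_blinfun.rep_eq cblinfun_apply.rep_eq)

lemma norm_cblinfun_apply: "norm (f x) \<le> norm f * norm x" for f :: "_ \<Rightarrow>\<^sub>C\<^sub>L _"
  by transfer (rule norm_blinfun)

lift_definition cblinfun_compose ::
    "('b::complex_normed_vector \<Rightarrow>\<^sub>C\<^sub>L 'c::complex_normed_vector) \<Rightarrow>
     ('a::complex_normed_vector \<Rightarrow>\<^sub>C\<^sub>L 'b) \<Rightarrow> 'a \<Rightarrow>\<^sub>C\<^sub>L 'c"  (infixl \<open>o\<^sub>C\<^sub>L\<close> 67)
  is "(o\<^sub>L)"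
  by simp

lift_definition id_cblinfun :: "'a::complex_normed_vector \<Rightarrow>\<^sub>C\<^sub>L 'a" is id_blinfun
  by simp

lemma cblinfun_apply_simps [simp]:
  "cblinfun_apply 0 x = 0"
  "cblinfun_apply (f + g) x = f x + g x"
  "cblinfun_apply (f - g) x = f x - g x"
  "cblinfun_apply (- f) x = - f x"
  "cblinfun_apply (c *\<^sub>C f) x = c *\<^sub>C f x"
  "cblinfun_apply (r *\<^sub>R f) x = r *\<^sub>R f x"
  "cblinfun_apply (h o\<^sub>C\<^sub>L f) x = h (f x)"
  "cblinfun_apply id_cblinfun y = y"
  by (transfer; simp add: blinfun.bilinear_simps scaleC_blinfun.rep_eq)+

lemma norm_cblinfun_compose: "norm (f o\<^sub>C\<^sub>L g) \<le> norm f * norm g"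
  by transfer (rule norm_blinfun_compose)

lemma norm_id_cblinfun_le: "norm (id_cblinfun :: 'a::complex_normed_vector \<Rightarrow>\<^sub>C\<^sub>L 'a) \<le> 1"
  by transfer (rule norm_blinfun_id_le)

type_synonym 'a cdual = "'a \<Rightarrow>\<^sub>C\<^sub>L complex"

definition cadjoint ::
    "('a::complex_normed_vector \<Rightarrow>\<^sub>C\<^sub>L 'b::complex_normed_vector) \<Rightarrow> 'b cdual \<Rightarrow>\<^sub>C\<^sub>L 'a cdual"
  where "cadjoint A = Abs_cblinfun (Blinfun (\<lambda>f. f o\<^sub>C\<^sub>L A))"

lemma cadjoint_apply [simp]: "cadjoint A f = f o\<^sub>C\<^sub>L A"
proof -
  have bl: "bounded_linear (\<lambda>f :: 'b cdual. f o\<^sub>C\<^sub>L A)"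
    by (rule bounded_linear_intro[of _ "norm A"])
      (auto intro!: cblinfun_eqI norm_cblinfun_compose)
  have "c *\<^sub>C g o\<^sub>C\<^sub>L A = c *\<^sub>C (g o\<^sub>C\<^sub>L A)" for c and g :: "'b cdual"
    by (rule cblinfun_eqI) simp
  then show ?thesis
    by (simp add: cadjoint_def cblinfun_apply.rep_eq Abs_cblinfun_inverse
        bounded_linear_Blinfun_apply[OF bl])
qed

definition point_spectrum :: "('a::complex_normed_vector \<Rightarrow>\<^sub>C\<^sub>L 'a) \<Rightarrow> complex set" where
  "point_spectrum T = {\<mu>. \<exists>v. v \<noteq> 0 \<and> T v = \<mu> *\<^sub>C v}"

definition rank_one :: "'a::complex_normed_vector cdual \<Rightarrow> 'b::complex_normed_vector \<Rightarrow> 'a \<Rightarrow>\<^sub>C\<^sub>L 'b"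
  where "rank_one f x = Abs_cblinfun (Blinfun (\<lambda>z. f z *\<^sub>C x))"

lemma rank_one_apply [simp]: "rank_one f x z = f z *\<^sub>C x"
proof -
  have bl: "bounded_linear (\<lambda>z. f z *\<^sub>C x)"
    by (rule bounded_linear_compose[OF bounded_linear_scaleC_left bounded_linear_cblinfun_apply])
  note app = bounded_linear_Blinfun_apply[OF bl]
  have "Blinfun (\<lambda>z. f z *\<^sub>C x) \<in> {g. \<forall>c y. blinfun_apply g (c *\<^sub>C y) = c *\<^sub>C blinfun_apply g y}"
    by (simp add: app cblinfun_apply_scaleC scaleC_complex_def)
  then show ?thesis
    by (simp only: rank_one_def cblinfun_apply.rep_eq[of "Abs_cblinfun _"] Abs_cblinfun_inverse app)
qed

text \<open>A norm \<open>N\<close> on a subspace \<open>J\<close> is a total function whose values outside \<open>J\<close> are irrelevant;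
  the induced distance is therefore cut off outside \<open>J\<close>.\<close>

definition norm_dist_on :: "'v::complex_vector set \<Rightarrow> ('v \<Rightarrow> real) \<Rightarrow> 'v \<Rightarrow> 'v \<Rightarrow> real" where
  "norm_dist_on J N S T = (if S \<in> J \<and> T \<in> J then N (S - T) else 0)"

abbreviation norm_topology_on :: "'v::complex_vector set \<Rightarrow> ('v \<Rightarrow> real) \<Rightarrow> 'v topology" where
  "norm_topology_on J N \<equiv> Metric_space.mtopology J (norm_dist_on J N)"

locale normed_subspace =
  fixes J :: "'v::complex_vector set" and N :: "'v \<Rightarrow> real"
  assumes subspace: "complex_vector.subspace J"
    and N_nonneg: "S \<in> J \<Longrightarrow> 0 \<le> N S"
    and N_eq_0_iff: "S \<in> J \<Longrightarrow> N S = 0 \<longleftrightarrow> S = 0"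
    and N_triangle: "S \<in> J \<Longrightarrow> T \<in> J \<Longrightarrow> N (S + T) \<le> N S + N T"
    and N_scaleC: "S \<in> J \<Longrightarrow> N (c *\<^sub>C S) = cmod c * N S"
begin

lemma N_minus_commute: "S \<in> J \<Longrightarrow> T \<in> J \<Longrightarrow> N (S - T) = N (T - S)"
  using N_scaleC[of "S - T" "-1"] complex_vector.subspace_diff[OF subspace] by simp

sublocale Metric_space J "norm_dist_on J N"
proof
  fix S T U
  note diff = complex_vector.subspace_diff[OF subspace]
  show "0 \<le> norm_dist_on J N S T"
    by (simp add: norm_dist_on_def N_nonneg diff)
  show "norm_dist_on J N S T = norm_dist_on J N T S"
    by (simp add: norm_dist_on_def N_minus_commute)
  show "norm_dist_on J N S T = 0 \<longleftrightarrow> S = T" if "S \<in> J" "T \<in> J"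
    using that by (simp add: norm_dist_on_def N_eq_0_iff diff)
  show "norm_dist_on J N S U \<le> norm_dist_on J N S T + norm_dist_on J N T U"
    if "S \<in> J" "T \<in> J" "U \<in> J"
    using that N_triangle[of "S - T" "T - U"] by (simp add: norm_dist_on_def diff)
qed

end

locale banach_ideal = normed_subspace J N
  for J :: "('a::complex_banach \<Rightarrow>\<^sub>C\<^sub>L 'a) set" and N :: "('a \<Rightarrow>\<^sub>C\<^sub>L 'a) \<Rightarrow> real" +
  assumes complete: "Metric_space.mcomplete J (norm_dist_on J N)"
    and norm_le: "S \<in> J \<Longrightarrow> norm S \<le> N S"
    and ideal: "S \<in> J \<Longrightarrow> B o\<^sub>C\<^sub>L S o\<^sub>C\<^sub>L A \<in> J"
    and ideal_norm: "S \<in> J \<Longrightarrow> N (B o\<^sub>C\<^sub>L S o\<^sub>C\<^sub>L A) \<le> norm B * norm A * N S"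
    and rank_one_mem: "rank_one f x \<in> J"
    and rank_one_norm: "N (rank_one f x) = norm f * norm x"

definition generalised_derivation ::
    "('a::complex_normed_vector \<Rightarrow>\<^sub>C\<^sub>L 'a) \<Rightarrow> ('a \<Rightarrow>\<^sub>C\<^sub>L 'a) \<Rightarrow> ('a \<Rightarrow>\<^sub>C\<^sub>L 'a) \<Rightarrow> 'a \<Rightarrow>\<^sub>C\<^sub>L 'a" where
  "generalised_derivation A B T = A o\<^sub>C\<^sub>L T - T o\<^sub>C\<^sub>L B"

text \<open>Hypercyclicity of a bounded operator \<open>U\<close> on the Banach space \<open>(J, N)\<close>; that \<open>U\<close> maps \<open>J\<close>
  into itself boundedly is not part of the predicate. For generalised derivations on Banach
  ideals it is shown below.\<close>

definition hypercyclic_on :: "'v::complex_vector set \<Rightarrow> ('v \<Rightarrow> real) \<Rightarrow> ('v \<Rightarrow> 'v) \<Rightarrow> bool" where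
  "hypercyclic_on J N U \<longleftrightarrow>
    (\<exists>y\<in>J. norm_topology_on J N closure_of range (\<lambda>n. (U ^^ n) y) = J)"

context banach_ideal
begin

lemma compose_left: "T \<in> J \<Longrightarrow> A o\<^sub>C\<^sub>L T \<in> J \<and> N (A o\<^sub>C\<^sub>L T) \<le> norm A * N T"
proof -
  assume T: "T \<in> J"
  have eq: "A o\<^sub>C\<^sub>L T o\<^sub>C\<^sub>L id_cblinfun = A o\<^sub>C\<^sub>L T"
    by (rule cblinfun_eqI) simp
  have "norm A * norm (id_cblinfun :: 'a \<Rightarrow>\<^sub>C\<^sub>L 'a) * N T \<le> norm A * 1 * N T"
    by (intro mult_right_mono mult_left_mono norm_id_cblinfun_le N_nonneg T norm_ge_zero)
  then show ?thesis
    using ideal[OF T, of A id_cblinfun] ideal_norm[OF T, of A id_cblinfun] eq by simp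
qed

lemma compose_right: "T \<in> J \<Longrightarrow> T o\<^sub>C\<^sub>L B \<in> J \<and> N (T o\<^sub>C\<^sub>L B) \<le> norm B * N T"
proof -
  assume T: "T \<in> J"
  have eq: "id_cblinfun o\<^sub>C\<^sub>L T o\<^sub>C\<^sub>L B = T o\<^sub>C\<^sub>L B"
    by (rule cblinfun_eqI) simp
  have "norm (id_cblinfun :: 'a \<Rightarrow>\<^sub>C\<^sub>L 'a) * norm B * N T \<le> 1 * norm B * N T"
    by (intro mult_right_mono norm_id_cblinfun_le N_nonneg T norm_ge_zero)
  then show ?thesis
    using ideal[OF T, of id_cblinfun B] ideal_norm[OF T, of id_cblinfun B] eq by simp
qed

lemma generalised_derivation_mem: "T \<in> J \<Longrightarrow> generalised_derivation A B T \<in> J"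
  unfolding generalised_derivation_def
  by (simp add: complex_vector.subspace_diff[OF subspace] compose_left compose_right)

lemma generalised_derivation_bounded:
  assumes "T \<in> J"
  shows "N (generalised_derivation A B T) \<le> (norm A + norm B) * N T"
proof -
  have J: "A o\<^sub>C\<^sub>L T \<in> J" "T o\<^sub>C\<^sub>L B \<in> J" "0 - T o\<^sub>C\<^sub>L B \<in> J"
    using assms compose_left compose_right complex_vector.subspace_diff[OF subspace]
      complex_vector.subspace_0[OF subspace] by blast+
  have "N (generalised_derivation A B T) \<le> N (A o\<^sub>C\<^sub>L T) + N (0 - T o\<^sub>C\<^sub>L B)"
    using N_triangle[OF J(1,3)] by (simp add: generalised_derivation_def)
  also have "N (0 - T o\<^sub>C\<^sub>L B) = N (T o\<^sub>C\<^sub>L B)"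
    using N_minus_commute[OF complex_vector.subspace_0[OF subspace] J(2)] by simp
  finally show ?thesis
    using compose_left[OF assms, of A] compose_right[OF assms, of B] by (simp add: algebra_simps)
qed

end

end

theory Submission
  imports Defs
begin

text \<open>Let \<open>f\<close> be an eigenvector of the adjoint of \<open>A\<close> with eigenvalue \<open>\<alpha>\<close>, and \<open>v\<close> an eigenvector
  of \<open>B\<close> with eigenvalue \<open>\<beta>\<close>. The functional \<open>\<phi> T = f (T v)\<close> is bounded on \<open>J\<close>, because the ideal
  norm dominates the operator norm, and
  \<open>\<phi> (A T - T B) = (\<alpha> - \<beta>) \<phi> T\<close>: it is an eigenvector of the adjoint of the generalised derivation
  (\<open>eigenfunctional_funpow\<close>). Hence \<open>\<phi>\<close> maps the orbit of \<open>y\<close> onto a geometric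
  progression \<open>(\<alpha> - \<beta>)^n \<phi> y\<close>. Such a progression is either bounded or bounded away from
  zero, so it always keeps a positive distance from some complex number
  (\<open>geometric_progression_not_dense\<close>). Since \<open>\<phi>\<close> is onto
  \<open>\<complex>\<close>, that number is \<open>\<phi> T\<close> for some \<open>T \<in> J\<close>, and boundedness of \<open>\<phi>\<close> keeps the orbit away
  from \<open>T\<close>.

  Surjectivity of \<open>\<phi>\<close> only needs one \<open>T \<in> J\<close> with \<open>f (T v) \<noteq> 0\<close>. A rank one operator
  \<open>rank_one g w\<close> with \<open>f w \<noteq> 0\<close> and \<open>g v \<noteq> 0\<close> will do, and the existence of \<open>g\<close> is where the
  Hahn--Banach theorem enters. It is obtained here without extending functionals from
  subspaces: by Zorn's lemma there is a minimal sublinear functional below a given one, and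
  minimal sublinear functionals are linear.\<close>

section \<open>Hahn--Banach through minimal sublinear functionals\<close>

definition sublinear :: "('a::real_vector \<Rightarrow> real) \<Rightarrow> bool" where
  "sublinear q \<longleftrightarrow> (\<forall>x y. q (x + y) \<le> q x + q y) \<and> (\<forall>r\<ge>0. \<forall>x. q (r *\<^sub>R x) = r * q x)"

lemma sublinear_add: "sublinear q \<Longrightarrow> q (x + y) \<le> q x + q y"
  by (simp add: sublinear_def)

lemma sublinear_scaleR: "sublinear q \<Longrightarrow> 0 \<le> r \<Longrightarrow> q (r *\<^sub>R x) = r * q x"
  by (simp add: sublinear_def)

lemma sublinear_zero: "sublinear q \<Longrightarrow> q 0 = 0"
  using sublinear_scaleR[of q 0 0] by simp

lemma sublinear_minus_le: "sublinear q \<Longrightarrow> - q (- x) \<le> q x"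
  using sublinear_add[of q x "- x"] by (simp add: sublinear_zero)

text \<open>For infima only one half of positive homogeneity is immediate; the other half is that same
  half applied to the inverse scalar.\<close>

lemma sublinearI:
  assumes add: "\<And>x y. q (x + y) \<le> q x + q y"
    and scale: "\<And>r x. 0 < r \<Longrightarrow> q (r *\<^sub>R x) \<le> r * q x"
  shows "sublinear q"
proof -
  have zero: "q 0 = 0"
    using add[of 0 0] scale[of "1/2" 0] by simp
  have "q (r *\<^sub>R x) = r * q x" if "0 < r" for r x
  proof (rule antisym[OF scale[OF that]])
    show "r * q x \<le> q (r *\<^sub>R x)"
      using scale[of "inverse r" "r *\<^sub>R x"] that by (simp add: field_simps)
  qed
  then have "q (r *\<^sub>R x) = r * q x" if "0 \<le> r" for r x
    using that zero by (cases "r = 0") auto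
  with add show ?thesis by (simp add: sublinear_def)
qed

lemma sublinear_norm: "sublinear (norm :: 'a::real_normed_vector \<Rightarrow> real)"
  by (simp add: sublinear_def norm_triangle_ineq)

text \<open>The largest sublinear functional \<open>r \<le> q\<close> with \<open>r (- y) \<le> - q y\<close>, that is, the functional
  obtained from \<open>q\<close> by enforcing linearity along the line through \<open>y\<close>.\<close>

definition sublinear_flatten :: "('a::real_vector \<Rightarrow> real) \<Rightarrow> 'a \<Rightarrow> 'a \<Rightarrow> real" where
  "sublinear_flatten q y x = (INF t\<in>{0..}. q (x + t *\<^sub>R y) - t * q y)"

lemma sublinear_flatten_le:
  assumes q: "sublinear q" and t: "0 \<le> t"
  shows "sublinear_flatten q y x \<le> q (x + t *\<^sub>R y) - t * q y"
  unfolding sublinear_flatten_def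
proof (rule cINF_lower)
  have "- q (- x) \<le> q (x + s *\<^sub>R y) - s * q y" if "0 \<le> s" for s
    using sublinear_add[OF q, of "x + s *\<^sub>R y" "- x"] sublinear_scaleR[OF q that, of y]
    by simp
  then show "bdd_below ((\<lambda>t. q (x + t *\<^sub>R y) - t * q y) ` {0..})"
    by (auto intro!: bdd_belowI[of _ "- q (- x)"])
qed (use t in simp)

lemma sublinear_flatten_greatest:
  assumes "\<And>t. 0 \<le> t \<Longrightarrow> c \<le> q (x + t *\<^sub>R y) - t * q y"
  shows "c \<le> sublinear_flatten q y x"
  unfolding sublinear_flatten_def by (rule cINF_greatest) (use assms in auto)

lemma sublinear_flatten_le_self: "sublinear q \<Longrightarrow> sublinear_flatten q y x \<le> q x"
  using sublinear_flatten_le[of q 0 y x] by simp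

lemma sublinear_flatten_minus: "sublinear q \<Longrightarrow> sublinear_flatten q y (- y) \<le> - q y"
  using sublinear_flatten_le[of q 1 y "- y"] by (simp add: sublinear_zero)

lemma sublinear_sublinear_flatten:
  assumes q: "sublinear q"
  shows "sublinear (sublinear_flatten q y)"
proof (rule sublinearI)
  let ?p = "sublinear_flatten q y"
  fix x x' :: 'a
  have "?p (x + x') - (q (x' + t' *\<^sub>R y) - t' * q y) \<le> q (x + t *\<^sub>R y) - t * q y"
    if "0 \<le> t" "0 \<le> t'" for t t'
    using sublinear_flatten_le[OF q, of "t + t'" y "x + x'"] that
      sublinear_add[OF q, of "x + t *\<^sub>R y" "x' + t' *\<^sub>R y"]
    by (simp add: algebra_simps)
  then have "?p (x + x') - (q (x' + t' *\<^sub>R y) - t' * q y) \<le> ?p x" if "0 \<le> t'" for t'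
    using that by (intro sublinear_flatten_greatest)
  then have "?p (x + x') - ?p x \<le> q (x' + t' *\<^sub>R y) - t' * q y" if "0 \<le> t'" for t'
    using that by fastforce
  then have "?p (x + x') - ?p x \<le> ?p x'"
    by (intro sublinear_flatten_greatest)
  then show "?p (x + x') \<le> ?p x + ?p x'" by simp
next
  let ?p = "sublinear_flatten q y"
  fix r :: real and x :: 'a
  assume r: "0 < r"
  have "?p (r *\<^sub>R x) / r \<le> q (x + t *\<^sub>R y) - t * q y" if "0 \<le> t" for t
    using sublinear_flatten_le[OF q, of "r * t" y "r *\<^sub>R x"] that r
      sublinear_scaleR[OF q, of r "x + t *\<^sub>R y"]
    by (simp add: field_simps scaleR_add_right)
  then have "?p (r *\<^sub>R x) / r \<le> ?p x"
    by (rule sublinear_flatten_greatest)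
  then show "?p (r *\<^sub>R x) \<le> r * ?p x"
    using r by (simp add: field_simps)
qed

text \<open>Members of the family lie above \<open>x \<mapsto> - p (- x)\<close>, so the pointwise infimum exists; it is
  subadditive because any two members of a chain can be replaced by the smaller one.\<close>

lemma sublinear_INF_chain:
  assumes "C \<noteq> {}"
    and sub: "\<And>q. q \<in> C \<Longrightarrow> sublinear q"
    and le: "\<And>q x. q \<in> C \<Longrightarrow> q x \<le> p x"
    and chain: "\<And>q r. q \<in> C \<Longrightarrow> r \<in> C \<Longrightarrow> q \<le> r \<or> r \<le> q"
  shows "sublinear (\<lambda>x. INF q\<in>C. q x)" and "q \<in> C \<Longrightarrow> (INF q\<in>C. q x) \<le> q x"
proof -
  have "- p (- z) \<le> r z" if "r \<in> C" for r z
    using sublinear_minus_le[OF sub[OF that], of z] le[OF that, of "- z"] by linarith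
  then have "bdd_below ((\<lambda>q. q z) ` C)" for z
    by (auto intro!: bdd_belowI[of _ "- p (- z)"])
  then have lower: "(INF q\<in>C. q z) \<le> r z" if "r \<in> C" for r z
    using that by (rule cINF_lower)
  then show "q \<in> C \<Longrightarrow> (INF q\<in>C. q x) \<le> q x" .
  show "sublinear (\<lambda>x. INF q\<in>C. q x)"
  proof (rule sublinearI)
    fix x y :: 'a
    let ?u = "\<lambda>x. INF q\<in>C. q x"
    have "?u (x + y) - r y \<le> q x" if qr: "q \<in> C" "r \<in> C" for q r
    proof -
      obtain m where m: "m \<in> C" "m \<le> q" "m \<le> r"
        using chain[OF qr] qr by auto
      have "?u (x + y) \<le> m x + m y"
        using lower[OF m(1), of "x + y"] sublinear_add[OF sub[OF m(1)], of x y] by linarith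
      then show ?thesis
        using le_funD[OF m(2), of x] le_funD[OF m(3), of y] by linarith
    qed
    then have "?u (x + y) - r y \<le> ?u x" if "r \<in> C" for r
      using that by (intro cINF_greatest[OF assms(1)])
    then have "?u (x + y) - ?u x \<le> r y" if "r \<in> C" for r
      using that by fastforce
    then have "?u (x + y) - ?u x \<le> ?u y"
      by (rule cINF_greatest[OF assms(1)])
    then show "?u (x + y) \<le> ?u x + ?u y" by simp
  next
    fix r :: real and x :: 'a
    let ?u = "\<lambda>x. INF q\<in>C. q x"
    assume r: "0 < r"
    have "?u (r *\<^sub>R x) / r \<le> q x" if "q \<in> C" for q
      using lower[OF that, of "r *\<^sub>R x"] sublinear_scaleR[OF sub[OF that], of r x] r
      by (simp add: field_simps)
    then have "?u (r *\<^sub>R x) / r \<le> ?u x"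
      by (rule cINF_greatest[OF assms(1)])
    then show "?u (r *\<^sub>R x) \<le> r * ?u x"
      using r by (simp add: field_simps)
  qed
qed

lemma exists_minimal_sublinear:
  assumes p: "sublinear p"
  obtains q where "sublinear q" "q \<le> p" "\<And>r. sublinear r \<Longrightarrow> r \<le> q \<Longrightarrow> r = q"
proof -
  let ?S = "{q. sublinear q \<and> q \<le> p}" and ?P = "\<lambda>q r :: 'a \<Rightarrow> real. r \<le> q"
  have "\<exists>m\<in>?S. \<forall>a\<in>?S. ?P m a \<longrightarrow> a = m"
  proof (rule predicate_Zorn)
    show "partial_order_on ?S (relation_of ?P ?S)"
      by (rule partial_order_on_relation_ofI) auto
  next
    fix C assume C: "C \<in> Chains (relation_of ?P ?S)"
    then have CS: "C \<subseteq> ?S" and chain: "\<And>q r. q \<in> C \<Longrightarrow> r \<in> C \<Longrightarrow> q \<le> r \<or> r \<le> q"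
      by (auto simp: Chains_def relation_of_def)
    show "\<exists>u\<in>?S. \<forall>a\<in>C. ?P a u"
    proof (cases "C = {}")
      case True
      with p show ?thesis by auto
    next
      case False
      have sub: "sublinear q" and le: "q x \<le> p x" if "q \<in> C" for q x
        using CS that by (auto simp: le_fun_def)
      have sub_INF: "sublinear (\<lambda>x. INF q\<in>C. q x)"
        using False sub le chain by (rule sublinear_INF_chain(1))
      have INF_le: "(INF q\<in>C. q x) \<le> q x" if "q \<in> C" for q x
        using False sub le chain that by (rule sublinear_INF_chain(2))
      have "(\<lambda>x. INF q\<in>C. q x) \<le> p"
      proof (rule le_funI)
        fix x
        obtain q where "q \<in> C" using False by auto
        then show "(INF q\<in>C. q x) \<le> p x" using INF_le[of q x] le[of q x] by linarith
      qed
      moreover have "(\<lambda>x. INF q\<in>C. q x) \<le> q" if "q \<in> C" for q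
        using INF_le[OF that] by (rule le_funI)
      ultimately show ?thesis
        using sub_INF by blast
    qed
  qed
  then show ?thesis using that by fastforce
qed

text \<open>Flattening a minimal functional along \<open>y\<close> does not change it, so it is already odd in
  direction \<open>y\<close>; an odd sublinear functional is linear.\<close>

lemma minimal_sublinear_linear:
  assumes q: "sublinear q" and min: "\<And>r. sublinear r \<Longrightarrow> r \<le> q \<Longrightarrow> r = q"
  shows "linear q"
proof -
  have odd: "q (- y) = - q y" for y
  proof -
    have "sublinear_flatten q y = q"
      by (intro min sublinear_sublinear_flatten[OF q] le_funI sublinear_flatten_le_self[OF q])
    then have "q (- y) \<le> - q y"
      using sublinear_flatten_minus[OF q, of y] by simp
    then show ?thesis using sublinear_minus_le[OF q, of y] by linarith
  qed
  show ?thesis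
  proof (rule linearI)
    show "q (x + y) = q x + q y" for x y
      using sublinear_add[OF q, of x y] sublinear_add[OF q, of "- x" "- y"] odd[of "x + y"]
        odd[of x] odd[of y] by simp
    show "q (r *\<^sub>R x) = r *\<^sub>R q x" for r x
    proof (cases "0 \<le> r")
      case True
      then show ?thesis by (simp add: sublinear_scaleR[OF q])
    next
      case False
      then show ?thesis
        using sublinear_scaleR[OF q, of "- r" x] odd[of "r *\<^sub>R x"] by simp
    qed
  qed
qed

text \<open>The minimal functional is taken below the norm flattened along \<open>v\<close>, whose value
  at \<open>- v\<close> is at most \<open>- norm v\<close>; linearity turns this into a lower bound at \<open>v\<close>.\<close>

lemma exists_norming_functional:
  fixes v :: "'a::real_normed_vector"
  obtains g where "linear g" "\<And>x. \<bar>g x\<bar> \<le> norm x" "g v = norm v"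
proof -
  let ?p = "sublinear_flatten norm v"
  obtain g where g: "sublinear g" "g \<le> ?p" "\<And>r. sublinear r \<Longrightarrow> r \<le> g \<Longrightarrow> r = g"
    using exists_minimal_sublinear[OF sublinear_sublinear_flatten[OF sublinear_norm]] by metis
  have lin: "linear g" by (rule minimal_sublinear_linear[OF g(1,3)])
  have le: "g x \<le> norm x" for x
    using le_funD[OF g(2), of x] sublinear_flatten_le_self[OF sublinear_norm, of v x] by linarith
  have abs: "\<bar>g x\<bar> \<le> norm x" for x
    using le[of x] le[of "- x"] linear_neg[OF lin, of x] by simp
  have "norm v \<le> g v"
    using le_funD[OF g(2), of "- v"] sublinear_flatten_minus[OF sublinear_norm, of v]
      linear_neg[OF lin, of v] by simp
  with le[of v] have "g v = norm v" by simp
  with lin abs show ?thesis by (rule that)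
qed

text \<open>A real functional \<open>g\<close> is the real part of the complex-linear functional
  \<open>x \<mapsto> g x - \<i> g (\<i> x)\<close>.\<close>

lemma cdual_separates:
  fixes v :: "'a::complex_normed_vector"
  assumes "v \<noteq> 0"
  obtains h :: "'a cdual" where "h v \<noteq> 0"
proof -
  obtain g where g: "linear g" "\<And>x. \<bar>g x\<bar> \<le> norm x" "g v = norm v"
    using exists_norming_functional[of v] by blast
  note g_simps = linear_add[OF g(1)] linear_scale[OF g(1)] linear_neg[OF g(1)]
  define k where "k x = Complex (g x) (- g (\<i> *\<^sub>C x))" for x
  have scaleC_split: "c *\<^sub>C x = Re c *\<^sub>R x + Im c *\<^sub>R (\<i> *\<^sub>C x)" for c and x :: 'a
  proof -
    have "c *\<^sub>C x = (complex_of_real (Re c) + complex_of_real (Im c) * \<i>) *\<^sub>C x"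
      by (simp add: complex_eq mult.commute)
    then show ?thesis by (simp only: scaleC_add_left scaleR_scaleC scaleC_scaleC)
  qed
  have scaleC: "k (c *\<^sub>C x) = c *\<^sub>C k x" for c x
  proof -
    have "\<i> *\<^sub>C c *\<^sub>C x = Re c *\<^sub>R (\<i> *\<^sub>C x) + (- Im c) *\<^sub>R x"
      using scaleC_split[of "\<i> * c" x] by simp
    moreover have "g (c *\<^sub>C x) = Re c * g x + Im c * g (\<i> *\<^sub>C x)"
      by (subst scaleC_split) (simp add: g_simps)
    ultimately show ?thesis
      by (simp add: k_def scaleC_complex_def complex_eq_iff g_simps linear_diff[OF g(1)])
  qed
  have bl: "bounded_linear k"
  proof (rule bounded_linear_intro[of _ 2])
    show "k (x + y) = k x + k y" for x y
      by (simp add: k_def complex_eq_iff scaleC_add_right g_simps)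
    show "k (r *\<^sub>R x) = r *\<^sub>R k x" for r x
      by (simp add: scaleR_scaleC scaleC)
    show "norm (k x) \<le> norm x * 2" for x
      using cmod_le[of "k x"] g(2)[of x] g(2)[of "\<i> *\<^sub>C x"] by (simp add: k_def)
  qed
  note app = bounded_linear_Blinfun_apply[OF bl]
  have "cblinfun_apply (Abs_cblinfun (Blinfun k)) v = k v"
    by (simp add: cblinfun_apply.rep_eq Abs_cblinfun_inverse app scaleC)
  also have "\<dots> \<noteq> 0"
    using assms g(3) by (simp add: k_def complex_eq_iff)
  finally show ?thesis by (rule that)
qed

section \<open>An eigenfunctional of the generalised derivation\<close>

lemma eigenfunctional_funpow:
  fixes A B :: "'a::complex_normed_vector \<Rightarrow>\<^sub>C\<^sub>L 'a" and f :: "'a cdual"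
  assumes A: "f o\<^sub>C\<^sub>L A = \<alpha> *\<^sub>C f" and B: "B v = \<beta> *\<^sub>C v"
  shows "f ((generalised_derivation A B ^^ n) T v) = (\<alpha> - \<beta>) ^ n * f (T v)"
proof (induction n)
  case (Suc n)
  have A': "f (A x) = \<alpha> * f x" for x
    using arg_cong[OF A, of "\<lambda>g. cblinfun_apply g x"] by (simp add: scaleC_complex_def)
  have "f (generalised_derivation A B S v) = (\<alpha> - \<beta>) * f (S v)" for S
    by (simp add: generalised_derivation_def linear_diff[OF bounded_linear.linear]
        bounded_linear_cblinfun_apply A' B cblinfun_apply_scaleC scaleC_complex_def algebra_simps)
  with Suc.IH show ?case by simp
qed simp

lemma (in banach_ideal) eigenfunctional_bounded:
  fixes f :: "'a cdual"
  assumes "S \<in> J" "T \<in> J"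
  shows "cmod (f (S v) - f (T v)) \<le> norm f * norm v * N (S - T)"
proof -
  have ST: "S - T \<in> J"
    using assms by (rule complex_vector.subspace_diff[OF subspace])
  have "cmod (f (S v) - f (T v)) = cmod (f ((S - T) v))"
    by (simp add: linear_diff[OF bounded_linear.linear] bounded_linear_cblinfun_apply)
  also have "\<dots> \<le> norm f * norm ((S - T) v)"
    by (rule norm_cblinfun_apply)
  also have "\<dots> \<le> norm f * (N (S - T) * norm v)"
    by (intro mult_left_mono order_trans[OF norm_cblinfun_apply] mult_right_mono
        norm_le ST norm_ge_zero)
  finally show ?thesis by (simp add: mult_ac)
qed

lemma (in banach_ideal) eigenfunctional_surj:
  fixes f :: "'a cdual"
  assumes "f \<noteq> 0" "v \<noteq> 0"
  obtains T where "T \<in> J" "f (T v) = z"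
proof -
  obtain w where w: "f w \<noteq> 0"
    using assms(1) cblinfun_eqI[of f 0] by auto
  obtain g :: "'a cdual" where g: "g v \<noteq> 0"
    using cdual_separates[OF assms(2)] .
  show ?thesis
  proof (rule that)
    show "rank_one g ((z / (g v * f w)) *\<^sub>C w) \<in> J"
      by (rule rank_one_mem)
    show "f (rank_one g ((z / (g v * f w)) *\<^sub>C w) v) = z"
      using w g by (simp add: cblinfun_apply_scaleC scaleC_complex_def)
  qed
qed

section \<open>Orbits are not dense\<close>

text \<open>If \<open>cmod l \<le> 1\<close> or \<open>c = 0\<close>, the progression stays in the closed disc of radius
  \<open>cmod c\<close>, and \<open>z = cmod c + 1\<close> has distance \<open>1\<close> from that disc; otherwise the progression never
  enters the open disc of radius \<open>cmod c > 0\<close>, and \<open>z = 0\<close> will do.\<close>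

lemma geometric_progression_not_dense:
  fixes l c :: complex
  obtains z d where "0 < d" "\<And>n. d \<le> cmod (l ^ n * c - z)"
proof (cases "cmod l \<le> 1 \<or> c = 0")
  case True
  have "1 \<le> cmod (l ^ n * c - complex_of_real (cmod c + 1))" for n
  proof -
    have "cmod (l ^ n * c) \<le> cmod c"
      using True
      by (cases "c = 0") (auto simp: norm_mult norm_power intro!: mult_left_le_one_le power_le_one)
    moreover have "cmod (complex_of_real (cmod c + 1)) = cmod c + 1"
      unfolding norm_of_real by simp
    ultimately show ?thesis
      using norm_triangle_ineq3[of "l ^ n * c" "complex_of_real (cmod c + 1)"] by linarith
  qed
  then show ?thesis using that[of 1] by auto
next
  case False
  have "cmod c \<le> cmod (l ^ n * c - 0)" for n
    using False one_le_power[of "cmod l" n] mult_right_mono[of 1 "cmod l ^ n" "cmod c"]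
    by (simp add: norm_mult norm_power)
  then show ?thesis using that[of "cmod c" 0] False by auto
qed

theorem proposition3p1:
  fixes A B :: "'a::complex_banach \<Rightarrow>\<^sub>C\<^sub>L 'a"
    and J :: "('a \<Rightarrow>\<^sub>C\<^sub>L 'a) set"
    and N :: "('a \<Rightarrow>\<^sub>C\<^sub>L 'a) \<Rightarrow> real"
  assumes "point_spectrum (cadjoint A) \<noteq> {}"
    and "point_spectrum B \<noteq> {}"
    and "banach_ideal J N"
    and "separable_space (norm_topology_on J N)"
  shows "\<not> hypercyclic_on J N (generalised_derivation A B)"
proof
  interpret banach_ideal J N by fact
  let ?\<tau> = "generalised_derivation A B"
  assume "hypercyclic_on J N ?\<tau>"
  then obtain y where dense: "mtopology closure_of range (\<lambda>n. (?\<tau> ^^ n) y) = J"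
    by (auto simp: hypercyclic_on_def)
  obtain \<alpha> and f :: "'a cdual" where f: "f \<noteq> 0" "f o\<^sub>C\<^sub>L A = \<alpha> *\<^sub>C f"
    using assms(1) by (auto simp: point_spectrum_def)
  obtain \<beta> v where v: "v \<noteq> 0" "B v = \<beta> *\<^sub>C v"
    using assms(2) by (auto simp: point_spectrum_def)
  obtain z d where d: "0 < d" "\<And>n. d \<le> cmod ((\<alpha> - \<beta>) ^ n * f (y v) - z)"
    using geometric_progression_not_dense[of "\<alpha> - \<beta>" "f (y v)"] by blast
  obtain T where T: "T \<in> J" "f (T v) = z"
    using eigenfunctional_surj[OF f(1) v(1)] .
  have M: "0 < norm f * norm v"
    using f(1) v(1) by simp
  have "T \<in> mtopology closure_of range (\<lambda>n. (?\<tau> ^^ n) y)"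
    using T(1) dense by simp
  then obtain n where n: "(?\<tau> ^^ n) y \<in> mball T (d / (norm f * norm v))"
    using divide_pos_pos[OF d(1) M] unfolding metric_closure_of by blast
  then have orbit: "(?\<tau> ^^ n) y \<in> J"
    and close: "N ((?\<tau> ^^ n) y - T) < d / (norm f * norm v)"
    using T(1) by (auto simp: in_mball norm_dist_on_def N_minus_commute)
  have "d \<le> cmod (f ((?\<tau> ^^ n) y v) - f (T v))"
    using d(2)[of n] eigenfunctional_funpow[OF f(2) v(2), of n y] T(2) by simp
  also have "\<dots> \<le> norm f * norm v * N ((?\<tau> ^^ n) y - T)"
    by (rule eigenfunctional_bounded[OF orbit T(1)])
  also have "\<dots> < d"
    using close M by (simp add: pos_less_divide_eq mult.commute)
  finally show False by simp
qed

end
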